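(* Let $q$ be a power of the odd prime $p$ and let $f$ be a planar function on $\mathbb F_{q^2}$ which either can be written as a Dembowski–Ostrom polynomial over $\mathbb F_{q^2}$ or is the Coulter–Matthews function $f(x)=x^{(3^k+1)/2}$ (with $p=3$, $q=3^n$, $\gcd(k,2n)=1$). Let $\theta\in\mathbb F_{q^2}^*$ be such that $\mathcal U_\theta:=\{(x,t\theta):x\in\mathbb F_{q^2},t\in\mathbb F_q\}\cup\{(\infty)\}$ is a unital in $\Pi(f)$. Then, as designs, $\mathcal U_\theta$ and the classical unital $\mathcal H$ of order $q$ are not isomorphic.
   Context: A Dembowski–Ostrom polynomial over $\mathbb F_{q^2}$ is one of the form $\sum_{i,j}a_{ij}x^{p^i+p^j}$ with $a_{ij}\in\mathbb F_{q^2}$; planar means $x\mapsto f(x+a)-f(x)$ is bijective for each $a\neq0$. $\Pi(f)$ is the projective plane with points $(x,y)\in\mathbb F_{q^2}^2$ and $(a)$ for $a\in\mathbb F_{q^2}\cup\{\infty\}$, lines $L_{a,b}=\{(x,f(x+a)-b):x\in\mathbb F_{q^2}\}\cup\{(a)\}$, $N_a=\{(a,y):y\in\mathbb F_{q^2}\}\cup\{(\infty)\}$ ($a,b\in\mathbb F_{q^2}$), $L_\infty=\{(a):a\in\mathbb F_{q^2}\cup\{\infty\}\}$. A unital in a projective plane of order $q^2$ is a set of $q^3+1$ points meeting every line in $1$ or $q+1$ points; it is regarded as a $2$-$(q^3+1,q+1,1)$ design whose blocks are its intersections with lines meeting it in $q+1$ points. The classical unital $\mathcal H$ is the Hermitian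 curve $\{(X:Y:Z)\in\mathrm{PG}(2,q^2):X^{q+1}+Y^{q+1}+Z^{q+1}=0\}$ with this design structure. Two designs are isomorphic if there is a bijection between their point sets mapping blocks onto blocks. *)

theory Defs
  imports Main "HOL-Computational_Algebra.Primes"
begin

definition planar :: "('a::field \<Rightarrow> 'a) \<Rightarrow> bool" where
  "planar f \<longleftrightarrow> (\<forall>a. a \<noteq> 0 \<longrightarrow> bij (\<lambda>x. f (x + a) - f x))"

definition is_DO :: "nat \<Rightarrow> ('a::field \<Rightarrow> 'a) \<Rightarrow> bool" where
  "is_DO p f \<longleftrightarrow> (\<exists>(N::nat) (c::nat \<Rightarrow> nat \<Rightarrow> 'a).
      \<forall>x. f x = (\<Sum>i<N. \<Sum>j<N. c i j * x ^ (p ^ i + p ^ j)))"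

definition is_CM :: "nat \<Rightarrow> nat \<Rightarrow> ('a::field \<Rightarrow> 'a) \<Rightarrow> bool" where
  "is_CM p n f \<longleftrightarrow> p = 3 \<and> (\<exists>k::nat. gcd k (2 * n) = 1 \<and>
      (\<forall>x. f x = x ^ ((3 ^ k + 1) div 2)))"

datatype 'a pt = Aff 'a 'a | Slope 'a | Infty

definition Pi_points :: "'a pt set" where
  "Pi_points = UNIV"

definition Pi_lines :: "('a::field \<Rightarrow> 'a) \<Rightarrow> 'a pt set set" where
  "Pi_lines f =
     {{Aff x (f (x + a) - b) | x. True} \<union> {Slope a} | a b. True}
   \<union> {{Aff a y | y. True} \<union> {Infty} | a. True}
   \<union> {{Slope a | a. True} \<union> {Infty}}"

definition pg_point :: "'a::field \<times> 'a \<times> 'a \<Rightarrow> ('a \<times> 'a \<times> 'a) set" where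
  "pg_point v = (case v of (x, y, z) \<Rightarrow> {(c * x, c * y, c * z) | c. c \<noteq> 0})"

definition PG_points :: "('a::field \<times> 'a \<times> 'a) set set" where
  "PG_points = {pg_point (x, y, z) | x y z. (x, y, z) \<noteq> (0, 0, 0)}"

definition PG_line :: "'a::field \<times> 'a \<times> 'a \<Rightarrow> ('a \<times> 'a \<times> 'a) set set" where
  "PG_line l = (case l of (a, b, c) \<Rightarrow>
      {pg_point (x, y, z) | x y z. (x, y, z) \<noteq> (0, 0, 0) \<and> a * x + b * y + c * z = 0})"

definition PG_lines :: "('a::field \<times> 'a \<times> 'a) set set set" where
  "PG_lines = {PG_line (a, b, c) | a b c. (a, b, c) \<noteq> (0, 0, 0)}"

definition hermitian :: "nat \<Rightarrow> ('a::field \<times> 'a \<times> 'a) set set" where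
  "hermitian q = {pg_point (x, y, z) | x y z. (x, y, z) \<noteq> (0, 0, 0) \<and>
      x ^ (q + 1) + y ^ (q + 1) + z ^ (q + 1) = 0}"

text \<open>A unital in a projective plane of order q^2 (given by points P and lines L).\<close>
definition is_unital :: "nat \<Rightarrow> 'p set \<Rightarrow> 'p set set \<Rightarrow> 'p set \<Rightarrow> bool" where
  "is_unital q P L U \<longleftrightarrow> U \<subseteq> P \<and> card U = q ^ 3 + 1 \<and>
      (\<forall>l\<in>L. card (U \<inter> l) = 1 \<or> card (U \<inter> l) = q + 1)"

definition unital_blocks :: "nat \<Rightarrow> 'p set set \<Rightarrow> 'p set \<Rightarrow> 'p set set" where
  "unital_blocks q L U = {U \<inter> l | l. l \<in> L \<and> card (U \<inter> l) = q + 1}"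

definition designs_isomorphic :: "'p set \<Rightarrow> 'p set set \<Rightarrow> 'r set \<Rightarrow> 'r set set \<Rightarrow> bool" where
  "designs_isomorphic P1 B1 P2 B2 \<longleftrightarrow>
     (\<exists>\<phi>. bij_betw \<phi> P1 P2 \<and> (\<lambda>B. \<phi> ` B) ` B1 = B2)"

text \<open>The set U_theta; F_q is the subfield {t. t^q = t} of F_(q^2).\<close>
definition U_theta :: "nat \<Rightarrow> 'a::field \<Rightarrow> 'a pt set" where
  "U_theta q \<theta> = {Aff x (t * \<theta>) | x t. t ^ q = t} \<union> {Infty}"

end

theory Submission
  imports Defs
begin

text \<open>Only two properties of \<open>f\<close> matter: it is planar and even. Put \<open>c x = x ^ q\<close>. With respect to
  a point \<open>E\<close> of the Hermitian curve the other points are the pairs \<open>(X, Y)\<close> with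
  \<open>Y + c Y = X * c X\<close>, the blocks on \<open>E\<close> are the fibres \<open>X = const\<close>, and the other blocks are the
  sections by lines \<open>Y = m * X + k\<close>, which lie over the circles with centre \<open>c m\<close> in the plane of
  the \<open>X\<close>, an affine plane over the field of fixed points of \<open>c\<close>.

  Suppose an isomorphism maps \<open>Infty\<close> to \<open>E\<close>, and let \<open>b\<close> be the induced bijection between fibres.
  Three fibres are collinear in the affine plane iff no block meets all of them, so collinearity is
  recognised by the design. As \<open>f\<close> is even, \<open>(x, y) \<mapsto> (2 * m - x, y)\<close> is an automorphism of
  \<open>U_theta\<close>; it induces on the affine plane an involutory collineation with the single fixed point
  \<open>b m\<close>, which must be the point reflection in \<open>b m\<close>. This determines the lift of the reflection
  to the Hermitian curve. The product of four reflections with alternating centres summing to \<open>0\<close>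
  is trivial on \<open>U_theta\<close>, where the translations commute, but not on the Hermitian curve, where
  they form a Heisenberg group.\<close>

section \<open>Fields with a conjugation\<close>

lemma even_card_fixpoint_free_involution:
  assumes "finite A" and "\<And>x. x \<in> A \<Longrightarrow> h x \<in> A" and "\<And>x. x \<in> A \<Longrightarrow> h (h x) = x"
    and "\<And>x. x \<in> A \<Longrightarrow> h x \<noteq> x"
  shows "even (card A)"
  using assms
proof (induction "card A" arbitrary: A rule: less_induct)
  case less
  show ?case
  proof (cases "A = {}")
    case False
    then obtain x where x: "x \<in> A" by blast
    have "even (card (A - {x, h x}))"
    proof (rule less.hyps)
      show "card (A - {x, h x}) < card A"
        using less.prems(1) x by (intro psubset_card_mono) auto
      show "h y \<in> A - {x, h x}" if "y \<in> A - {x, h x}" for y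
        using that less.prems(2,3) x by (metis DiffE DiffI insertCI insertE singletonD)
    qed (use less.prems in auto)
    moreover have "card (A - {x, h x}) + 2 = card A"
    proof -
      have sub: "{x, h x} \<subseteq> A" and card2: "card {x, h x} = 2"
        using less.prems(2,4) x by (auto simp: card_2_iff)
      show ?thesis
        using card_mono[OF less.prems(1) sub] card_Diff_subset[OF _ sub] card2 by simp
    qed
    ultimately show ?thesis by presburger
  qed simp
qed

lemma finite_field_pow_card:
  fixes x :: "'a::{field,finite}"
  shows "x ^ card (UNIV :: 'a set) = x"
proof (cases "x = 0")
  case False
  let ?N = "UNIV - {0::'a}"
  have "\<Prod>?N = (\<Prod>y\<in>?N. x * y)"
    using False by (intro prod.reindex_bij_witness[of _ "\<lambda>y. x * y" "\<lambda>y. y / x"]) auto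
  also have "\<dots> = x ^ card ?N * \<Prod>?N"
    by (simp add: prod.distrib)
  finally have "x ^ card ?N = 1"
    by simp
  moreover have "card (UNIV :: 'a set) = Suc (card ?N)"
    by (rule card.remove) auto
  ultimately show ?thesis by (metis mult_1_right power_Suc)
qed (simp add: finite_UNIV_card_ge_0)

locale conjugation =
  fixes c :: "'a::field \<Rightarrow> 'a"
  assumes c_add: "c (x + y) = c x + c y"
    and c_mult: "c (x * y) = c x * c y"
    and c_c [simp]: "c (c x) = x"
    and two: "(2::'a) \<noteq> 0"
begin

lemma c_0 [simp]: "c 0 = 0"
  by (metis add_cancel_right_right add.right_neutral c_add)

lemma c_eq_0 [simp]: "c x = 0 \<longleftrightarrow> x = 0"
  by (metis c_0 c_c)

lemma c_1 [simp]: "c 1 = 1"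
  using c_mult[of 1 1] by (metis c_eq_0 mult_cancel_left1 mult_1 one_neq_zero)

lemma c_minus [simp]: "c (- x) = - c x"
  using c_add[of x "- x"] by (simp add: eq_neg_iff_add_eq_0 add.commute)

lemma c_diff: "c (x - y) = c x - c y"
  using c_add[of x "- y"] by simp

lemma c_2 [simp]: "c 2 = 2"
  using c_add[of 1 1] by simp

lemma c_divide: "c (x / y) = c x / c y"
  by (cases "y = 0") (simp_all add: eq_divide_eq flip: c_mult)

lemmas c_simps = c_add c_mult c_diff c_divide

definition area :: "'a \<Rightarrow> 'a \<Rightarrow> 'a" where
  "area v w = v * c w - c v * w"

lemma area_diff_left: "area (u - v) w = area u w - area v w"
  and area_diff_right: "area w (u - v) = area w u - area w v"
  and area_add_left: "area (u + v) w = area u w + area v w"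
  and area_add_right: "area w (u + v) = area w u + area w v"
  by (simp_all add: area_def c_simps algebra_simps)

lemma area_scale:
  assumes "c r = r"
  shows "area (r * v) w = r * area v w" and "area v (r * w) = r * area v w"
  using assms by (simp_all add: area_def c_simps algebra_simps)

lemma area_self [simp]: "area v v = 0" and area_0 [simp]: "area 0 v = 0" "area v 0 = 0"
  by (simp_all add: area_def)

lemma area_swap: "area w v = - area v w"
  by (simp add: area_def)

lemma area_minus [simp]: "area (- v) w = - area v w" "area v (- w) = - area v w"
  by (simp_all add: area_def)

lemma area_eq_0_ratio:
  assumes "area v w = 0" "v \<noteq> 0"
  shows "c (w / v) = w / v"
  using assms by (auto simp: area_def c_simps field_simps)

definition collinear :: "'a \<Rightarrow> 'a \<Rightarrow> 'a \<Rightarrow> bool" where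
  "collinear x y z \<longleftrightarrow> area (y - x) (z - x) = 0"

lemma involution_fixing_lines:
  assumes fin: "finite (UNIV::'a set)" and odd: "odd (card {t. c t = t})"
    and inv: "\<And>v. \<tau> (\<tau> v) = v" and fixp: "\<And>v. \<tau> v = v \<longleftrightarrow> v = 0"
    and coll: "\<And>x y z. collinear x y z \<Longrightarrow> collinear (\<tau> x) (\<tau> y) (\<tau> z)"
  shows "area v (\<tau> v) = 0"
proof (cases "v = 0")
  case False
  let ?d = "\<tau> v - v"
  have d: "?d \<noteq> 0" using False fixp by auto
  define L where "L = {z. area ?d (z - v) = 0}"
  have "L = (\<lambda>t. v + t * ?d) ` {t. c t = t}"
  proof (intro equalityI subsetI)
    fix z assume "z \<in> L"
    then have "c ((z - v) / ?d) = (z - v) / ?d"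
      using area_eq_0_ratio d by (auto simp: L_def)
    moreover have "z = v + (z - v) / ?d * ?d" using d by simp
    ultimately show "z \<in> (\<lambda>t. v + t * ?d) ` {t. c t = t}" by blast
  qed (auto simp: L_def area_scale)
  moreover have "inj_on (\<lambda>t. v + t * ?d) {t. c t = t}"
    using d by (auto intro!: inj_onI)
  ultimately have "odd (card L)"
    using odd by (simp add: card_image)
  moreover have "\<tau> z \<in> L" if "z \<in> L" for z
  proof -
    have "collinear v (\<tau> v) z" using that by (simp add: L_def collinear_def)
    then have "area (v - \<tau> v) (\<tau> z - \<tau> v) = 0"
      using coll inv by (metis collinear_def)
    then show ?thesis
      by (simp add: L_def area_diff_left area_diff_right area_swap[of v "\<tau> v"] algebra_simps)
  qed
  ultimately obtain z where "z \<in> L" "\<tau> z = z"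
    using even_card_fixpoint_free_involution[of L \<tau>] inv finite_subset[OF subset_UNIV fin]
    by blast
  then have "area ?d (- v) = 0"
    using fixp by (auto simp: L_def)
  then show ?thesis
    by (simp add: area_diff_left area_swap[of v "\<tau> v"])
qed simp

lemma involution_is_point_reflection:
  assumes fin: "finite (UNIV::'a set)" and odd: "odd (card {t. c t = t})"
    and nontriv: "c j \<noteq> j"
    and inv: "\<And>v. \<tau> (\<tau> v) = v" and fixp: "\<And>v. \<tau> v = v \<longleftrightarrow> v = 0"
    and coll: "\<And>x y z. collinear x y z \<Longrightarrow> collinear (\<tau> x) (\<tau> y) (\<tau> z)"
  shows "\<tau> v = - v"
proof (cases "v = 0")
  case True
  then show ?thesis using fixp by simp
next
  case False
  define l where "l x = \<tau> x / x" for x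
  have tau: "\<tau> x = l x * x" for x
    using fixp by (cases "x = 0") (auto simp: l_def)
  have cl: "c (l x) = l x" for x
    unfolding l_def
    using area_eq_0_ratio involution_fixing_lines[OF fin odd inv fixp coll]
    by (cases "x = 0") auto
  have l0: "l x \<noteq> 0" if "x \<noteq> 0" for x
    using that inv[of x] fixp[of 0] by (auto simp: tau)
  have l1: "l x \<noteq> 1" if "x \<noteq> 0" for x
    using that fixp[of x] tau by auto
  txt \<open>If the multipliers differed, the line through \<open>x\<close> and \<open>y\<close> would meet its image in a point
    \<open>z \<noteq> 0\<close>, and would contain the multiple \<open>\<tau> z\<close> of \<open>z\<close>, hence pass through \<open>0\<close>.\<close>
  have eq: "l x = l y" if ind: "area x y \<noteq> 0" for x y
  proof (rule ccontr)
    assume ne: "l x \<noteq> l y"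
    define r where "r = (1 - l x) / (l y - l x)"
    define s where "s = r * l y"
    have cr: "c r = r" and cs: "c s = s"
      by (simp_all add: r_def s_def c_simps cl)
    define z where "z = x + s * (y - x)"
    have "r * (l y - l x) = 1 - l x" using ne by (simp add: r_def)
    moreover have "z - (\<tau> x + r * (\<tau> y - \<tau> x)) = x * (1 - l x - r * (l y - l x))"
      by (simp add: z_def s_def tau algebra_simps)
    ultimately have z': "z = \<tau> x + r * (\<tau> y - \<tau> x)"
      by simp
    have "collinear (\<tau> x) (\<tau> y) z"
      by (simp add: collinear_def z' area_scale cr)
    then have "collinear x y (\<tau> z)"
      using coll inv by metis
    then have "area (y - x) (l z * z - x) = 0"
      by (simp add: collinear_def tau)
    moreover have "l z * z - x = (l z - 1) * x + l z * (s * (y - x))"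
      by (simp add: z_def algebra_simps)
    moreover have "c (l z - 1) = l z - 1" using cl by (simp add: c_simps)
    ultimately have "(l z - 1) * area (y - x) x = 0"
      by (simp add: area_add_right area_scale cl cs)
    then have "l z = 1"
      using ind by (simp add: area_diff_left area_swap[of x y])
    then have "z = 0" using l1 by blast
    then have "area z y = 0" "area x z = 0" by simp_all
    then have "(1 - s) * area x y = 0" "s * area x y = 0"
      by (simp_all add: z_def area_add_left area_add_right area_diff_left area_diff_right area_scale cs
          algebra_simps)
    then show False using ind by auto
  qed
  obtain w where w: "area v w \<noteq> 0"
  proof -
    have "area v (j * v) = v * c v * (c j - j)"
      by (simp add: area_def c_simps algebra_simps)
    then show ?thesis using that[of "j * v"] False nontriv by simp
  qed
  then have "area (\<tau> v) w \<noteq> 0"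
    using False l0 by (simp add: tau area_scale cl)
  then have "l (\<tau> v) = l v" using eq w by metis
  then have "l v * l v * v = v" using inv[of v] tau by (simp add: mult.assoc)
  then have "l v * l v = 1" using False by simp
  then have "l v = - 1" using l1[OF False] square_eq_1_iff by blast
  then show ?thesis by (simp add: tau)
qed

end

section \<open>Coordinates on the Hermitian curve\<close>

fun scale :: "'a::field \<Rightarrow> 'a \<times> 'a \<times> 'a \<Rightarrow> 'a \<times> 'a \<times> 'a" where
  "scale k (x, y, z) = (k * x, k * y, k * z)"

fun lincomb :: "'a::field \<Rightarrow> 'a \<times> 'a \<times> 'a \<Rightarrow> 'a \<Rightarrow> 'a \<times> 'a \<times> 'a \<Rightarrow> 'a \<Rightarrow> 'a \<times> 'a \<times> 'a
    \<Rightarrow> 'a \<times> 'a \<times> 'a" where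
  "lincomb r (u1, u2, u3) s (v1, v2, v3) t (w1, w2, w3) =
    (r * u1 + s * v1 + t * w1, r * u2 + s * v2 + t * w2, r * u3 + s * v3 + t * w3)"

lemma pg_point_scale: "pg_point v = {scale k v | k. k \<noteq> 0}"
  by (cases v) (simp add: pg_point_def)

lemma mem_pg_point: "v \<in> pg_point v"
  unfolding pg_point_scale by (cases v) (auto intro!: exI[of _ 1])

lemma pg_point_eqD:
  assumes "pg_point v = pg_point u"
  shows "\<exists>k. k \<noteq> 0 \<and> v = scale k u"
  using assms mem_pg_point[of v] by (auto simp: pg_point_scale)

lemma pg_point_scale_eq:
  assumes "k \<noteq> 0"
  shows "pg_point (scale k v) = pg_point v"
proof -
  obtain x y z where v: "v = (x, y, z)" by (cases v)
  have "\<exists>j. j \<noteq> 0 \<and> scale i v = scale j (scale k v)" if "i \<noteq> 0" for i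
    using assms that by (intro exI[of _ "i / k"]) (simp add: v)
  moreover have "\<exists>j. j \<noteq> 0 \<and> scale i (scale k v) = scale j v" if "i \<noteq> 0" for i
    using assms that by (intro exI[of _ "i * k"]) (simp add: v mult.assoc)
  ultimately show ?thesis
    unfolding pg_point_scale by blast
qed

lemma pg_point_mem_PG_line:
  assumes "(x, y, z) \<noteq> (0, 0, 0)"
  shows "pg_point (x, y, z) \<in> PG_line (l, m, n) \<longleftrightarrow> l * x + m * y + n * z = 0"
proof
  assume "pg_point (x, y, z) \<in> PG_line (l, m, n)"
  then obtain x' y' z' where eq: "pg_point (x, y, z) = pg_point (x', y', z')"
    and line: "l * x' + m * y' + n * z' = 0"
    by (auto simp: PG_line_def)
  from pg_point_eqD[OF eq] obtain k where "(x, y, z) = scale k (x', y', z')" by blast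
  then have "l * x + m * y + n * z = k * (l * x' + m * y' + n * z')"
    by (simp add: algebra_simps)
  then show "l * x + m * y + n * z = 0" by (simp add: line)
qed (use assms in \<open>auto simp: PG_line_def\<close>)

context conjugation
begin

fun form :: "'a \<times> 'a \<times> 'a \<Rightarrow> 'a \<times> 'a \<times> 'a \<Rightarrow> 'a" where
  "form (x, y, z) (x', y', z') = x * c x' + y * c y' + z * c z'"

lemma form_swap: "form v u = c (form u v)"
  by (cases u; cases v) (simp add: c_simps algebra_simps)

lemma form_lincomb_left: "form (lincomb r u s v t w) z = r * form u z + s * form v z + t * form w z"
  by (cases u; cases v; cases w; cases z) (simp add: algebra_simps)

lemma form_lincomb_right:
  "form z (lincomb r u s v t w) = c r * form z u + c s * form z v + c t * form z w"
  by (cases u; cases v; cases w; cases z) (simp add: c_simps algebra_simps)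

lemma form_scale: "form (scale k u) v = k * form u v"
  by (cases u; cases v) (simp add: algebra_simps)

lemma hermitian_iff_form:
  fixes S :: "('a \<times> 'a \<times> 'a) set"
  assumes "\<And>x. c x = x ^ q"
  shows "S \<in> hermitian q \<longleftrightarrow> (\<exists>v. S = pg_point v \<and> v \<noteq> (0, 0, 0) \<and> form v v = 0)"
  unfolding hermitian_def split_paired_Ex by (simp add: assms)

lemma isotropic_basis:
  assumes e: "form e e = 0" and e0: "e \<noteq> (0, 0, 0)"
  obtains f w where "form f e = 1" "form f f = 0" "form w e = 0" "form w f = 0" "form w w = - 1"
    "\<And>z. form z e = 0 \<Longrightarrow> form z f = 0 \<Longrightarrow> form z w = 0 \<Longrightarrow> z = (0, 0, 0)"
proof -
  obtain e1 e2 e3 where e123: "e = (e1, e2, e3)" by (cases e)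
  have "\<exists>u. form u e = 1"
  proof -
    consider "e1 \<noteq> 0" | "e2 \<noteq> 0" | "e3 \<noteq> 0" using e0 e123 by auto
    then show ?thesis
    proof cases
      case 1
      then show ?thesis by (intro exI[of _ "(1 / c e1, 0, 0)"]) (simp add: e123)
    next
      case 2
      then show ?thesis by (intro exI[of _ "(0, 1 / c e2, 0)"]) (simp add: e123)
    next
      case 3
      then show ?thesis by (intro exI[of _ "(0, 0, 1 / c e3)"]) (simp add: e123)
    qed
  qed
  then obtain u where u: "form u e = 1" by blast
  then have u': "form e u = 1" using form_swap[of e u] by simp
  define f where "f = lincomb 1 u (- form u u / 2) e 0 e"
  have cuu: "c (form u u) = form u u" using form_swap[of u u] by simp
  have fe: "form f e = 1" by (simp add: f_def form_lincomb_left u e)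
  then have ef: "form e f = 1" using form_swap[of e f] by simp
  have ff: "form f f = 0"
    using two by (simp add: f_def form_lincomb_left form_lincomb_right u u' e c_simps cuu field_simps)
  obtain f1 f2 f3 where f123: "f = (f1, f2, f3)" by (cases f)
  define g1 g2 g3 where g_def: "g1 = e2 * f3 - e3 * f2" "g2 = e3 * f1 - e1 * f3" "g3 = e1 * f2 - e2 * f1"
  \<comment> \<open>conjugate cross product of \<open>e\<close> and \<open>f\<close>; Lagrange's identity gives its norm\<close>
  define w where "w = (c g1, c g2, c g3)"
  have we: "form w e = 0" and wf: "form w f = 0"
    by (simp_all add: w_def e123 f123 g_def algebra_simps flip: c_mult c_add c_diff)
  have lagrange: "c g1 * g1 + c g2 * g2 + c g3 * g3 = form e e * form f f - form e f * form f e"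
    by (simp add: e123 f123 g_def c_simps algebra_simps)
  then have ww: "form w w = - 1"
    by (simp add: w_def e fe ef)
  have "z = (0, 0, 0)" if z: "form z e = 0" "form z f = 0" "form z w = 0" for z
  proof -
    obtain z1 z2 z3 where z123: "z = (z1, z2, z3)" by (cases z)
    let ?d = "c g1 * g1 + c g2 * g2 + c g3 * g3"
    have d: "?d = - 1" using lagrange by (simp add: e fe ef)
    have "z1 * ?d = form z e * (c f2 * g3 - c f3 * g2) + form z f * (g2 * c e3 - g3 * c e2) + form z w * c g1"
      by (simp add: z123 e123 f123 w_def, simp add: g_def c_simps algebra_simps)
    moreover have "z2 * ?d = form z e * (c f3 * g1 - c f1 * g3) + form z f * (g3 * c e1 - g1 * c e3) + form z w * c g2"
      by (simp add: z123 e123 f123 w_def, simp add: g_def c_simps algebra_simps)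
    moreover have "z3 * ?d = form z e * (c f1 * g2 - c f2 * g1) + form z f * (g1 * c e2 - g2 * c e1) + form z w * c g3"
      by (simp add: z123 e123 f123 w_def, simp add: g_def c_simps algebra_simps)
    ultimately show ?thesis unfolding z d by (simp add: z123)
  qed
  then show ?thesis using that fe ff we wf ww by blast
qed

lemma hermitian_coordinates:
  fixes E :: "('a \<times> 'a \<times> 'a) set"
  assumes cq: "\<And>x. c x = x ^ q" and E: "E \<in> hermitian q"
  obtains pt where
    "bij_betw (\<lambda>(x, y). pt x y) {(x, y). y + c y = x * c x} (hermitian q - {E})"
    "\<And>l. l \<in> PG_lines \<Longrightarrow> \<exists>A B C. (A, B, C) \<noteq> (0, 0, 0) \<and> (E \<in> l \<longleftrightarrow> C = 0) \<and>
       (\<forall>x y. pt x y \<in> l \<longleftrightarrow> A + B * x + C * y = 0)"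
proof -
  note herm = hermitian_iff_form[OF cq]
  obtain e where E_e: "E = pg_point e" and e0: "e \<noteq> (0, 0, 0)" and ee: "form e e = 0"
    using E herm by blast
  obtain f w where fe: "form f e = 1" and ff: "form f f = 0"
    and we: "form w e = 0" and wf: "form w f = 0" and ww: "form w w = - 1"
    and nondeg: "\<And>z. form z e = 0 \<Longrightarrow> form z f = 0 \<Longrightarrow> form z w = 0 \<Longrightarrow> z = (0, 0, 0)"
    using isotropic_basis[OF ee e0] by metis
  have ef: "form e f = 1" using form_swap[of e f] fe by simp
  have ew: "form e w = 0" and fw: "form f w = 0"
    using form_swap[of e w] form_swap[of f w] we wf by simp_all
  note gram = ee fe ff we wf ww ef ew fw form_lincomb_left form_lincomb_right
  define v where "v x y = lincomb 1 f x w y e" for x y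
  have v_forms: "form (v x y) e = 1" "form (v x y) w = - x" "form (v x y) f = y" for x y
    by (simp_all add: v_def gram)
  have v_norm: "form (v x y) (v x y) = y + c y - x * c x" for x y
    by (simp add: v_def gram)
  have v0: "v x y \<noteq> (0, 0, 0)" for x y
    using v_forms(1)[of x y] by (cases e) auto
  define pt where "pt x y = pg_point (v x y)" for x y
  have expand: "z = lincomb (form z e) f (- form z w) w (form z f) e" for z
  proof -
    have "lincomb 1 z (- 1) (lincomb (form z e) f (- form z w) w (form z f) e) 0 z = (0, 0, 0)"
      by (rule nondeg) (simp_all add: gram)
    then show ?thesis
      by (cases z; cases "lincomb (form z e) f (- form z w) w (form z f) e") simp
  qed
  have "bij_betw (\<lambda>(x, y). pt x y) {(x, y). y + c y = x * c x} (hermitian q - {E})"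
  proof (rule bij_betwI')
    fix P Q :: "'a \<times> 'a"
    obtain x y x' y' where PQ: "P = (x, y)" "Q = (x', y')" by fastforce
    have "P = Q" if eq: "pt x y = pt x' y'"
    proof -
      obtain k where "v x y = scale k (v x' y')"
        using pg_point_eqD[OF eq[unfolded pt_def]] by blast
      then have "form (v x y) z = k * form (v x' y') z" for z by (simp add: form_scale)
      from this[of e] this[of w] this[of f] show ?thesis by (simp add: v_forms PQ)
    qed
    then show "((case P of (x, y) \<Rightarrow> pt x y) = (case Q of (x, y) \<Rightarrow> pt x y)) = (P = Q)"
      by (auto simp: PQ)
  next
    fix P :: "'a \<times> 'a"
    assume "P \<in> {(x, y). y + c y = x * c x}"
    then obtain x y where P: "P = (x, y)" "y + c y = x * c x" by blast
    have "pt x y \<noteq> E"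
    proof
      assume eq: "pt x y = E"
      obtain k where "v x y = scale k e"
        using pg_point_eqD[OF eq[unfolded pt_def E_e]] by blast
      then have "form (v x y) e = k * form e e" by (simp add: form_scale)
      then show False by (simp add: v_forms ee)
    qed
    moreover have "pt x y \<in> hermitian q"
    proof -
      have "form (v x y) (v x y) = 0" using v_norm P by simp
      then show ?thesis unfolding herm pt_def using v0 by blast
    qed
    ultimately show "(case P of (x, y) \<Rightarrow> pt x y) \<in> hermitian q - {E}"
      by (simp add: P)
  next
    fix S assume "S \<in> hermitian q - {E}"
    then obtain z where S: "S = pg_point z" "S \<noteq> E" and z: "z \<noteq> (0, 0, 0)" "form z z = 0"
      using herm by blast
    define r s t where rst: "r = form z e" "s = - form z w" "t = form z f"
    have z_eq: "z = lincomb r f s w t e" using expand rst by simp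
    then have norm: "r * c t + t * c r - s * c s = 0" using z(2) by (simp add: gram algebra_simps)
    have "r \<noteq> 0"
    proof
      assume r: "r = 0"
      then have "s = 0" using norm by simp
      then have "z = scale t e" using z_eq r by (cases e; cases f; cases w) simp
      moreover have "t \<noteq> 0" using \<open>z = scale t e\<close> z(1) by (cases e) auto
      ultimately show False using S E_e pg_point_scale_eq by metis
    qed
    then have "z = scale r (v (s / r) (t / r))"
      using z_eq by (cases e; cases f; cases w) (simp add: v_def algebra_simps)
    then have "S = pt (s / r) (t / r)"
      using S(1) pg_point_scale_eq \<open>r \<noteq> 0\<close> by (simp add: pt_def)
    moreover have "t / r + c (t / r) = s / r * c (s / r)"
      using \<open>r \<noteq> 0\<close> norm by (simp add: c_simps field_simps)
    ultimately show "\<exists>P\<in>{(x, y). y + c y = x * c x}. S = (case P of (x, y) \<Rightarrow> pt x y)"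
      by blast
  qed
  moreover have "\<exists>A B C. (A, B, C) \<noteq> (0, 0, 0) \<and> (E \<in> l \<longleftrightarrow> C = 0) \<and>
       (\<forall>x y. pt x y \<in> l \<longleftrightarrow> A + B * x + C * y = 0)" if line: "l \<in> PG_lines" for l
  proof -
    obtain l1 l2 l3 where l: "l = PG_line (l1, l2, l3)" and l0: "(l1, l2, l3) \<noteq> (0, 0, 0)"
      using line by (auto simp: PG_lines_def)
    let ?m = "(c l1, c l2, c l3)"
    have mem: "pg_point z \<in> l \<longleftrightarrow> form z ?m = 0" if "z \<noteq> (0, 0, 0)" for z
      using that by (cases z) (simp add: l pg_point_mem_PG_line mult.commute)
    have "(form f ?m, form w ?m, form e ?m) \<noteq> (0, 0, 0)"
    proof
      assume "(form f ?m, form w ?m, form e ?m) = (0, 0, 0)"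
      then have "form ?m f = 0" "form ?m w = 0" "form ?m e = 0"
        using form_swap[of ?m] by (metis Pair_inject c_0)+
      then show False using nondeg[of ?m] l0 by simp
    qed
    moreover have "form (v x y) ?m = form f ?m + form w ?m * x + form e ?m * y" for x y
      unfolding v_def form_lincomb_left by (simp add: mult.commute)
    ultimately show ?thesis
      unfolding pt_def E_e mem[OF e0] mem[OF v0] by metis
  qed
  ultimately show ?thesis using that by blast
qed

end

section \<open>Circles and reflections\<close>

context conjugation
begin

definition cocircular :: "'a \<Rightarrow> 'a \<Rightarrow> 'a \<Rightarrow> bool" where
  "cocircular x y z \<longleftrightarrow> (\<exists>u. (x - u) * c (x - u) = (y - u) * c (y - u) \<and>
     (x - u) * c (x - u) = (z - u) * c (z - u))"

lemma collinear_iff_not_cocircular: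
  assumes "x \<noteq> y" "y \<noteq> z" "x \<noteq> z"
  shows "collinear x y z \<longleftrightarrow> \<not> cocircular x y z"
proof
  assume col: "collinear x y z"
  show "\<not> cocircular x y z"
  proof
    assume "cocircular x y z"
    then obtain u where u: "(x - u) * c (x - u) = (y - u) * c (y - u)"
      "(x - u) * c (x - u) = (z - u) * c (z - u)"
      unfolding cocircular_def by blast
    define p where "p = y - x"
    define e where "e = x - u"
    define r where "r = (z - x) / p"
    have p0: "p \<noteq> 0" using assms by (simp add: p_def)
    have cr: "c r = r"
      using col area_eq_0_ratio p0 by (simp add: collinear_def p_def r_def)
    have y: "y - u = p + e" and z: "z - u = r * p + e"
      using p0 by (simp_all add: p_def e_def r_def)
    have "p * c e + c p * e = - (p * c p)"
      using u(1) unfolding y by (simp add: e_def[symmetric] c_simps algebra_simps eq_neg_iff_add_eq_0)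
    moreover have "r * r * (p * c p) + r * (p * c e + c p * e) = 0"
      using u(2) unfolding z by (simp add: e_def[symmetric] c_simps cr algebra_simps)
    ultimately have "r * (r - 1) * (p * c p) = 0"
      by (simp add: algebra_simps)
    then have "r = 0 \<or> r = 1" using p0 by simp
    then show False using assms p0 by (auto simp: r_def p_def)
  qed
next
  show "collinear x y z" if nc: "\<not> cocircular x y z"
  proof (rule ccontr)
    define p r where "p = y - x" and "r = z - x"
    define A where "A = area p r"
    define e where "e = (p * c p * r - r * c r * p) / A"
    assume "\<not> collinear x y z"
    then have A0: "A \<noteq> 0" by (simp add: collinear_def A_def p_def r_def)
    have cA: "c A = - A" by (simp add: A_def area_def c_simps)
    have Ae: "A * e = p * c p * r - r * c r * p"
      using A0 by (simp add: e_def)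
    then have "c (A * e) = c (p * c p * r - r * c r * p)" by simp
    then have Ace: "A * c e = r * c r * c p - p * c p * c r"
      by (simp add: c_simps cA minus_equation_iff[of "A * c e"] algebra_simps)
    have "A * (p * c e + c p * e) = p * (A * c e) + c p * (A * e)"
      "A * (r * c e + c r * e) = r * (A * c e) + c r * (A * e)"
      by (simp_all add: algebra_simps)
    then have "A * (p * c e + c p * e) = A * - (p * c p)" "A * (r * c e + c r * e) = A * - (r * c r)"
      unfolding Ae Ace by (simp_all add: A_def area_def algebra_simps)
    then have "p * c e + c p * e = - (p * c p)" "r * c e + c r * e = - (r * c r)"
      using A0 mult_left_cancel by blast+
    moreover have "(z + e) * c (z + e) = (z * c e + c z * e) + z * c z + e * c e" for z
      by (simp add: c_simps algebra_simps)
    ultimately have "(p + e) * c (p + e) = e * c e" "(r + e) * c (r + e) = e * c e"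
      by simp_all
    then have "cocircular x y z"
      unfolding cocircular_def by (intro exI[of _ "x - e"]) (simp add: p_def r_def algebra_simps)
    then show False using nc by blast
  qed
qed

lemma collinear_degenerate:
  assumes "x = y \<or> y = z \<or> x = z"
  shows "collinear x y z"
  using assms by (auto simp: collinear_def)

lemma collinear_translate: "collinear (x - v) (y - v) (z - v) \<longleftrightarrow> collinear x y z"
  by (simp add: collinear_def)

lemma line_norm:
  assumes "Y + c Y = X * c X" and "Y = m * X + k"
  shows "(X - c m) * c (X - c m) = m * c m + k + c k"
  using assms by (simp add: c_simps algebra_simps)

end

locale planar_hermitian = conjugation c for c :: "'a::field \<Rightarrow> 'a" +
  fixes f :: "'a \<Rightarrow> 'a" and T :: "'a set" and b :: "'a \<Rightarrow> 'a" and Y :: "'a \<Rightarrow> 'a \<Rightarrow> 'a"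
  assumes fin: "finite (UNIV :: 'a set)"
    and odd_fixed: "odd (card {t. c t = t})"
    and f_even: "f (- x) = f x"
    and zero_mem: "0 \<in> T" and diff_mem: "s \<in> T \<Longrightarrow> t \<in> T \<Longrightarrow> s - t \<in> T"
    and b_bij: "bij b"
    and norm: "y \<in> T \<Longrightarrow> Y x y + c (Y x y) = b x * c (b x)"
    and onto: "h + c h = b x * c (b x) \<Longrightarrow> \<exists>y\<in>T. Y x y = h"
    and lines: "\<lbrakk>x1 \<noteq> x2; x2 \<noteq> x3; x1 \<noteq> x3; y1 \<in> T; y2 \<in> T; y3 \<in> T\<rbrakk> \<Longrightarrow>
      (\<exists>a d. y1 = f (x1 + a) - d \<and> y2 = f (x2 + a) - d \<and> y3 = f (x3 + a) - d) \<longleftrightarrow>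
      (\<exists>m k. Y x1 y1 = m * b x1 + k \<and> Y x2 y2 = m * b x2 + k \<and> Y x3 y3 = m * b x3 + k)"
    and third: "\<lbrakk>x1 \<noteq> x2; f (x2 + a) - f (x1 + a) \<in> T\<rbrakk> \<Longrightarrow>
      \<exists>x3. x3 \<noteq> x1 \<and> x3 \<noteq> x2 \<and> f (x3 + a) - f (x1 + a) \<in> T"
begin

lemma add_mem: "s \<in> T \<Longrightarrow> t \<in> T \<Longrightarrow> s + t \<in> T"
  using diff_mem[of s "0 - t"] diff_mem[OF zero_mem] by simp

lemma b_eq [simp]: "b x = b y \<longleftrightarrow> x = y"
  using b_bij by (auto simp: bij_def inj_def)

lemma cocircular_image:
  assumes "x1 \<noteq> x2" "x2 \<noteq> x3" "x1 \<noteq> x3"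
  shows "cocircular (b x1) (b x2) (b x3) \<longleftrightarrow>
    (\<exists>a. f (x2 + a) - f (x1 + a) \<in> T \<and> f (x3 + a) - f (x1 + a) \<in> T)"
proof
  assume "cocircular (b x1) (b x2) (b x3)"
  then obtain u where u: "(b x1 - u) * c (b x1 - u) = (b x2 - u) * c (b x2 - u)"
      "(b x1 - u) * c (b x1 - u) = (b x3 - u) * c (b x3 - u)"
    unfolding cocircular_def by blast
  define g where "g = (b x1 - u) * c (b x1 - u)"
  define k where "k = (g - u * c u) / 2"
  have "c k = k"
    by (simp add: k_def g_def c_simps mult.commute)
  moreover have "2 * k = g - u * c u"
    using two by (simp add: k_def)
  ultimately have k: "k + c k = g - u * c u"
    by (metis mult_2)
  have "\<exists>y\<in>T. Y x y = c u * b x + k" if "(b x - u) * c (b x - u) = g" for x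
  proof (rule onto)
    have "c u * b x + k + c (c u * b x + k) = c u * b x + u * c (b x) + (k + c k)"
      by (simp add: c_simps add_ac)
    also have "\<dots> = b x * c (b x)"
      unfolding k that[symmetric] by (simp add: c_diff algebra_simps)
    finally show "c u * b x + k + c (c u * b x + k) = b x * c (b x)" .
  qed
  from this[of x1] this[of x2] this[of x3]
  obtain y1 y2 y3 where y: "y1 \<in> T" "y2 \<in> T" "y3 \<in> T" "Y x1 y1 = c u * b x1 + k"
      "Y x2 y2 = c u * b x2 + k" "Y x3 y3 = c u * b x3 + k"
    using u unfolding g_def by auto
  then obtain a d where "y1 = f (x1 + a) - d" "y2 = f (x2 + a) - d" "y3 = f (x3 + a) - d"
    using lines[OF assms y(1-3)] by blast
  then show "\<exists>a. f (x2 + a) - f (x1 + a) \<in> T \<and> f (x3 + a) - f (x1 + a) \<in> T"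
    using diff_mem[OF y(2,1)] diff_mem[OF y(3,1)] by (intro exI[of _ a]) simp
next
  assume "\<exists>a. f (x2 + a) - f (x1 + a) \<in> T \<and> f (x3 + a) - f (x1 + a) \<in> T"
  then obtain a where a: "f (x2 + a) - f (x1 + a) \<in> T" "f (x3 + a) - f (x1 + a) \<in> T" by blast
  have "0 = f (x1 + a) - f (x1 + a)" by simp
  then obtain m k where "Y x1 0 = m * b x1 + k" "Y x2 (f (x2 + a) - f (x1 + a)) = m * b x2 + k"
      "Y x3 (f (x3 + a) - f (x1 + a)) = m * b x3 + k"
    using lines[OF assms zero_mem a] by blast
  note this(1)[THEN line_norm[OF norm[OF zero_mem]]] this(2)[THEN line_norm[OF norm[OF a(1)]]]
    this(3)[THEN line_norm[OF norm[OF a(2)]]]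
  then show "cocircular (b x1) (b x2) (b x3)"
    unfolding cocircular_def by (intro exI[of _ "c m"]) simp
qed

lemma collinear_reflect:
  assumes "collinear (b x1) (b x2) (b x3)"
  shows "collinear (b (2 * m - x1)) (b (2 * m - x2)) (b (2 * m - x3))"
proof (cases "x1 \<noteq> x2 \<and> x2 \<noteq> x3 \<and> x1 \<noteq> x3")
  case True
  have dist: "2 * m - x1 \<noteq> 2 * m - x2" "2 * m - x2 \<noteq> 2 * m - x3" "2 * m - x1 \<noteq> 2 * m - x3"
    using True by auto
  have "cocircular (b x1) (b x2) (b x3)"
    if "cocircular (b (2 * m - x1)) (b (2 * m - x2)) (b (2 * m - x3))"
  proof -
    have f: "f (2 * m - x + a) = f (x + (- 2 * m - a))" for x a
      using f_even[of "2 * m - x + a"] by (simp add: algebra_simps)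
    show ?thesis
      using that True unfolding cocircular_image[OF dist] f by (subst cocircular_image) blast+
  qed
  then show ?thesis
    using assms True dist collinear_iff_not_cocircular b_eq by meson
next
  case False
  then show ?thesis by (intro collinear_degenerate) auto
qed

lemma b_reflect:
  assumes "c j \<noteq> j"
  shows "b (2 * m - x) = 2 * b m - b x"
proof -
  define g where "g = inv b"
  have bg [simp]: "b (g z) = z" and gb [simp]: "g (b z) = z" for z
    using b_bij by (simp_all add: g_def bij_def surj_f_inv_f)
  define \<tau> where "\<tau> v = b (2 * m - g (b m + v)) - b m" for v
  have "\<tau> v = - v" for v
  proof (rule involution_is_point_reflection[OF fin odd_fixed assms])
    fix v x y z
    show "\<tau> (\<tau> v) = v" by (simp add: \<tau>_def)
    have "\<tau> v = v \<longleftrightarrow> b (2 * m - g (b m + v)) = b (g (b m + v))"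
      unfolding bg by (simp add: \<tau>_def diff_eq_eq add.commute)
    also have "\<dots> \<longleftrightarrow> 2 * m = 2 * g (b m + v)"
      unfolding b_eq by (simp add: diff_eq_eq)
    also have "\<dots> \<longleftrightarrow> b m = b (g (b m + v))"
      using two unfolding b_eq by simp
    finally show "\<tau> v = v \<longleftrightarrow> v = 0" by simp
    assume "collinear x y z"
    then have "collinear (b (g (b m + x))) (b (g (b m + y))) (b (g (b m + z)))"
      using collinear_translate[of "b m + x" "b m" "b m + y" "b m + z"] by simp
    then show "collinear (\<tau> x) (\<tau> y) (\<tau> z)"
      unfolding \<tau>_def collinear_translate by (rule collinear_reflect)
  qed
  from this[of "b x - b m"] show ?thesis
    by (simp add: \<tau>_def algebra_simps)
qed

text \<open>The block through \<open>(x, y)\<close> and its mirror image is invariant under the reflection in the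
  fibre of \<open>m\<close>, so the circle below it has centre \<open>b m\<close>, which fixes the slope of its image.\<close>

lemma Y_reflect:
  assumes j: "c j \<noteq> j" and y: "y \<in> T"
  shows "Y (2 * m - x) y = Y x y + 2 * c (b m) * (b m - b x)"
proof (cases "x = m")
  case True
  then show ?thesis by simp
next
  case False
  note b_refl = b_reflect[OF j]
  define x' where "x' = 2 * m - x"
  have "2 * x \<noteq> 2 * m" using False two by simp
  then have xx': "x \<noteq> x'" by (auto simp: x'_def mult_2 algebra_simps)
  have f_refl: "f (2 * m - z + (- m)) = f (z + (- m))" for z
    using f_even[of "z - m"] by (simp add: algebra_simps)
  obtain x3 where x3: "x3 \<noteq> x" "x3 \<noteq> x'" and x3T: "f (x3 + (- m)) - f (x + (- m)) \<in> T"
    using third[OF xx', of "- m"] f_refl[of x] zero_mem unfolding x'_def by auto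
  define d where "d = f (x + (- m)) - y"
  define y3 where "y3 = f (x3 + (- m)) - d"
  have y3: "y3 \<in> T" using add_mem[OF x3T y] by (simp add: y3_def d_def algebra_simps)
  have yd: "y = f (x + (- m)) - d" "y = f (x' + (- m)) - d" "y3 = f (x3 + (- m)) - d"
    "y3 = f (2 * m - x3 + (- m)) - d"
    unfolding x'_def f_refl by (simp_all add: d_def y3_def)
  obtain r k where rk: "Y x y = r * b x + k" "Y x' y = r * b x' + k" "Y x3 y3 = r * b x3 + k"
    using lines[OF xx' _ _ y y y3, of x3] x3 yd by metis
  have rk3: "Y (2 * m - x3) y3 = r * b (2 * m - x3) + k"
  proof -
    have "x' \<noteq> 2 * m - x3" "x \<noteq> 2 * m - x3"
      using x3 by (auto simp: x'_def)
    then obtain r' k' where rk': "Y x y = r' * b x + k'" "Y x' y = r' * b x' + k'"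
        "Y (2 * m - x3) y3 = r' * b (2 * m - x3) + k'"
      using lines[OF xx' _ _ y y y3, of "2 * m - x3"] yd by metis
    have "(r - r') * (b x - b x') =
        (r * b x + k - (r' * b x + k')) - (r * b x' + k - (r' * b x' + k'))"
      by (simp add: algebra_simps)
    also have "\<dots> = 0"
      using rk(1,2) rk'(1,2) by (metis diff_self)
    finally have "(r - r') * (b x - b x') = 0" .
    then have "r = r'" using xx' by simp
    then show ?thesis using rk rk' by auto
  qed
  define e where "e = b m - c r"
  have orth: "v * c e + c v * e = 0" if z: "z \<in> T" "Y x0 z = r * b x0 + k"
    "Y (2 * m - x0) z = r * b (2 * m - x0) + k" and v: "v = b x0 - b m" for x0 z v
  proof -
    have "(b x0 - c r) * c (b x0 - c r) = (2 * b m - b x0 - c r) * c (2 * b m - b x0 - c r)"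
      using line_norm[OF norm z(2)] line_norm[OF norm z(3)] z(1) by (simp add: b_refl)
    moreover have "b x0 - c r = v + e" "2 * b m - b x0 - c r = e - v"
      by (simp_all add: e_def v)
    ultimately have "(v + e) * c (v + e) = (e - v) * c (e - v)"
      by metis
    then have "2 * (v * c e + c v * e) = 0"
      by (simp add: c_simps algebra_simps)
    then show ?thesis using two mult_eq_0_iff by blast
  qed
  have "e = 0"
  proof (rule ccontr)
    assume e0: "e \<noteq> 0"
    define v w where "v = b x - b m" and "w = b x3 - b m"
    have "v * c e = - (c v * e)" "w * c e = - (c w * e)"
      using orth[OF y rk(1) _ v_def] rk(2) orth[OF y3 rk(3) rk3 w_def]
      by (simp_all add: x'_def eq_neg_iff_add_eq_0)
    moreover have "area v w * (e * c e) = c w * e * (v * c e) - c v * e * (w * c e)"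
      by (simp add: area_def algebra_simps)
    ultimately have "area v w * (e * c e) = 0"
      by (simp add: algebra_simps)
    then have "area v w = 0" using e0 by simp
    moreover have "b x' - b x = - (v + v)" "b x3 - b x = w - v"
      by (simp_all add: v_def w_def x'_def b_refl)
    moreover have "area (- (v + v)) (w - v) = - (2 * area v w)"
      by (simp only: area_minus area_add_left area_diff_right area_self mult_2) simp
    ultimately have "collinear (b x) (b x') (b x3)"
      by (simp only: collinear_def) simp
    moreover have "cocircular (b x) (b x') (b x3)"
      using line_norm norm rk y y3 unfolding cocircular_def by metis
    ultimately show False
      using xx' x3 by (simp add: collinear_iff_not_cocircular)
  qed
  then have "r = c (b m)" using c_c[of r] by (simp add: e_def)
  then show ?thesis
    using rk(1,2) unfolding x'_def b_refl by (simp add: algebra_simps)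
qed

text \<open>The product of the reflections in four points with \<open>a1 - a2 + a3 - a4 = 0\<close> is the identity
  on the planar side, but a nontrivial central translation on the Hermitian side.\<close>

lemma conjugation_trivial: "c j = j"
proof (rule ccontr)
  assume j: "c j \<noteq> j"
  obtain a1 a2 a3 where a: "b a1 = 1" "b a2 = 0" "b a3 = j"
    using b_bij by (metis bij_pointE)
  define a4 where "a4 = a1 - a2 + a3"
  define x1 where "x1 = 2 * a1 - 0"
  define x2 where "x2 = 2 * a2 - x1"
  define x3 where "x3 = 2 * a3 - x2"
  have x4: "2 * a4 - x3 = 0" by (simp add: a4_def x3_def x2_def x1_def algebra_simps)
  note b_refl = b_reflect[OF j]
  have b1: "b x1 = 2 - b 0" and b2: "b x2 = b 0 - 2" and b3: "b x3 = 2 * j + 2 - b 0"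
    by (simp_all add: x1_def[unfolded diff_0_right] x2_def x3_def b_refl a)
      (use b_refl[of a1 0] in \<open>simp_all add: x1_def a algebra_simps\<close>)
  have "2 * b a4 = b x3 + b 0" using b_refl[of a4 x3] by (simp add: x4)
  then have "2 * b a4 = 2 * (1 + j)" by (simp add: b3 algebra_simps)
  then have b4: "b a4 = 1 + j" using mult_left_cancel[OF two] by blast
  have "Y 0 0 = Y x3 0 + 2 * c (b a4) * (b a4 - b x3)"
    using Y_reflect[OF j zero_mem, of a4 x3] by (simp add: x4)
  also have "Y x3 0 = Y x2 0 + 2 * c (b a3) * (b a3 - b x2)"
    unfolding x3_def by (rule Y_reflect[OF j zero_mem])
  also have "Y x2 0 = Y x1 0 + 2 * c (b a2) * (b a2 - b x1)"
    unfolding x2_def by (rule Y_reflect[OF j zero_mem])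
  also have "Y x1 0 = Y 0 0 + 2 * c (b a1) * (b a1 - b 0)"
    unfolding x1_def by (rule Y_reflect[OF j zero_mem])
  finally have "2 * (j - c j) = 0"
    by (simp add: a b1 b2 b3 b4 c_simps algebra_simps)
  then show False using j two by auto
qed

end

section \<open>Transfer from the unital\<close>

lemma line_slope_form:
  fixes A :: "'a::field"
  assumes "(A, B, C) \<noteq> (0, 0, 0)" "A + B * x1 + C * y1 = 0" "A + B * x2 + C * y2 = 0" "x1 \<noteq> x2"
  obtains m k where "\<And>x y. A + B * x + C * y = 0 \<longleftrightarrow> y = m * x + k"
proof -
  have "C \<noteq> 0"
  proof
    assume C: "C = 0"
    have "B * (x1 - x2) = (A + B * x1 + C * y1) - (A + B * x2 + C * y2)"
      by (simp add: C algebra_simps)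
    then have "B = 0" using assms by simp
    then show False using assms C by simp
  qed
  then have "A + B * x + C * y = 0 \<longleftrightarrow> y = - B / C * x + - A / C" for x y
    by (simp add: field_simps add_eq_0_iff)
  then show ?thesis using that by blast
qed

lemma even_if_DO_or_CM:
  fixes f :: "'a::field \<Rightarrow> 'a"
  assumes "odd p" and "is_DO p f \<or> is_CM p n f"
  shows "f (- x) = f x"
  using assms(2)
proof
  assume "is_DO p f"
  then obtain N c where f: "\<And>x. f x = (\<Sum>i<N. \<Sum>j<N. c i j * x ^ (p ^ i + p ^ j))"
    unfolding is_DO_def by blast
  have "even (p ^ i + p ^ j)" for i j using assms(1) by simp
  then show ?thesis unfolding f by (simp add: power_minus_even)
next
  assume "is_CM p n f"
  then obtain k where k: "gcd k (2 * n) = 1" and f: "\<And>x. f x = x ^ ((3 ^ k + 1) div 2)"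
    unfolding is_CM_def by auto
  have "odd k"
  proof
    assume "even k"
    then have "2 dvd gcd k (2 * n)" by simp
    then show False using k by simp
  qed
  then obtain i where i: "k = 2 * i + 1" by (auto elim: oddE)
  have "(3::nat) ^ k mod 4 = 3"
  proof -
    have "((3::nat) ^ 2) ^ i mod 4 = (3 ^ 2 mod 4) ^ i mod 4" by (rule power_mod[symmetric])
    then have "(9::nat) ^ i mod 4 = 1" by simp
    moreover have "(3::nat) ^ k = 3 * 9 ^ i" by (simp add: i power_mult)
    ultimately show ?thesis by (metis mod_mult_right_eq mult_1_right mod_less numeral_less_iff semiring_norm(76,79,81))
  qed
  then have "even ((3 ^ k + 1) div (2::nat))" by presburger
  then show ?thesis unfolding f by (simp add: power_minus_even)
qed

lemma conjugation_power:
  assumes "prime p" "odd p" "n \<ge> 1" "q = p ^ n" "card (UNIV :: 'a::{field,finite} set) = q ^ 2"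
  shows "conjugation (\<lambda>x::'a. x ^ q)"
proof -
  have "(\<Sum>x\<in>UNIV. x) = (\<Sum>x\<in>UNIV. x + (1::'a))"
    by (rule sum.reindex_bij_witness[of _ "\<lambda>x. x + 1" "\<lambda>x. x - 1"]) auto
  then have "of_nat (card (UNIV :: 'a set)) = (0::'a)"
    by (simp add: sum.distrib)
  then have "CHAR('a) dvd p ^ (n * 2)"
    by (simp only: of_nat_eq_0_iff_char_dvd assms power_mult)
  moreover have char: "prime CHAR('a)"
    by (intro prime_CHAR_semidom finite_imp_CHAR_pos) simp
  ultimately have p: "CHAR('a) = p"
    using assms(1) by (metis prime_dvd_power primes_dvd_imp_eq)
  show ?thesis
  proof
    fix x y :: 'a
    show "(x + y) ^ q = x ^ q + y ^ q"
      using freshmans_dream'[OF char] p assms(4) by simp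
    show "(x * y) ^ q = x ^ q * y ^ q" by (rule power_mult_distrib)
    show "(x ^ q) ^ q = x"
      using finite_field_pow_card[of x] assms(5) by (simp add: power2_eq_square power_mult)
    have "\<not> p dvd 2" using assms(1,2) by (metis primes_dvd_imp_eq two_is_prime_nat even_numeral)
    then show "(2::'a) \<noteq> 0"
      using of_nat_eq_0_iff_char_dvd[of 2, where 'a = 'a] p by simp
  qed
qed

lemma U_theta_card_fixed:
  fixes \<theta> :: "'a::{field,finite}"
  assumes "\<theta> \<noteq> 0" "card (U_theta q \<theta>) = q ^ 3 + 1" "card (UNIV :: 'a set) = q ^ 2" "q > 0"
  shows "card {t::'a. t ^ q = t} = q"
proof -
  let ?F = "{t::'a. t ^ q = t}" and ?g = "\<lambda>(x, t). Aff x (t * \<theta>)"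
  have "U_theta q \<theta> = insert Infty (?g ` (UNIV \<times> ?F))"
    by (auto simp: U_theta_def image_def)
  moreover have "inj_on ?g (UNIV \<times> ?F)"
    using assms(1) by (auto simp: inj_on_def)
  moreover have "Infty \<notin> ?g ` (UNIV \<times> ?F)" by auto
  ultimately have "card (U_theta q \<theta>) = Suc (q ^ 2 * card ?F)"
    using assms(3) by (simp add: card_image card_cartesian_product)
  then have "q ^ 2 * card ?F = q ^ 3"
    using assms(2) by simp
  also have "\<dots> = q ^ 2 * q" by (simp add: eval_nat_numeral)
  finally show ?thesis using assms(4) by simp
qed

theorem theorem4p7:
  fixes p q n :: nat and f :: "'a::{field,finite} \<Rightarrow> 'a" and \<theta> :: 'a
  assumes "prime p" and "odd p" and "n \<ge> 1" and "q = p ^ n"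
    and "card (UNIV :: 'a set) = q ^ 2"
    and "planar f"
    and "is_DO p f \<or> is_CM p n f"
    and "\<theta> \<noteq> 0"
    and "is_unital q Pi_points (Pi_lines f) (U_theta q \<theta>)"
  shows "\<not> designs_isomorphic
            (U_theta q \<theta>) (unital_blocks q (Pi_lines f) (U_theta q \<theta>))
            (hermitian q :: ('a \<times> 'a \<times> 'a) set set)
            (unital_blocks q (PG_lines :: ('a \<times> 'a \<times> 'a) set set set) (hermitian q))"
proof
  define U where "U = U_theta q \<theta>"
  define H :: "('a \<times> 'a \<times> 'a) set set" where "H = hermitian q"
  define BU where "BU = unital_blocks q (Pi_lines f) U"
  define BH :: "('a \<times> 'a \<times> 'a) set set set" where "BH = unital_blocks q PG_lines H"
  assume "designs_isomorphic (U_theta q \<theta>) (unital_blocks q (Pi_lines f) (U_theta q \<theta>))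
    (hermitian q :: ('a \<times> 'a \<times> 'a) set set) (unital_blocks q PG_lines (hermitian q))"
  then obtain \<phi> where \<phi>: "bij_betw \<phi> U H" and blocks: "(\<lambda>B. \<phi> ` B) ` BU = BH"
    unfolding designs_isomorphic_def U_def H_def BU_def BH_def by blast
  have q0: "q > 0" using assms(1,4) prime_gt_0_nat by simp
  have q_odd: "odd q" using assms(2,4) by simp
  have "q \<noteq> 1"
    using assms(1,3,4) by (metis nat_power_eq_Suc_0_iff One_nat_def not_one_le_zero not_prime_1)
  then have q3: "q \<ge> 3" using q0 q_odd by presburger
  have unital: "card U = q ^ 3 + 1" "\<And>l. l \<in> Pi_lines f \<Longrightarrow> card (U \<inter> l) = 1 \<or> card (U \<inter> l) = q + 1"
    using assms(9) by (auto simp: is_unital_def U_def)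
  define c where "c = (\<lambda>x::'a. x ^ q)"
  interpret conjugation c
    unfolding c_def by (rule conjugation_power[OF assms(1-5)])
  have card_fixed: "card {t. c t = t} = q"
    unfolding c_def
    by (rule U_theta_card_fixed[OF assms(8) unital(1)[unfolded U_def] assms(5) q0])
  obtain j where j: "c j \<noteq> j"
  proof -
    have "q ^ 2 \<noteq> q" using q3 by (simp add: power2_eq_square)
    then have "{t. c t = t} \<noteq> UNIV" using card_fixed assms(5) by metis
    then show ?thesis using that by blast
  qed
  define T where "T = {t * \<theta> | t. c t = t}"
  have U_eq: "U = {Aff x y | x y. y \<in> T} \<union> {Infty}"
    unfolding U_def U_theta_def T_def c_def by blast
  have Aff_U [simp]: "Aff x y \<in> U \<longleftrightarrow> y \<in> T" and Infty_U [simp]: "Infty \<in> U"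
    and Slope_U [simp]: "Slope a \<notin> U" for x y a
    by (auto simp: U_eq)
  have zero_T: "0 \<in> T" unfolding T_def by (auto intro!: exI[of _ 0])
  have diff_T: "s - t \<in> T" if st: "s \<in> T" "t \<in> T" for s t
  proof -
    obtain s' t' where "c s' = s'" "c t' = t'" "s = s' * \<theta>" "t = t' * \<theta>"
      using st unfolding T_def by blast
    then show ?thesis
      unfolding T_def by (auto intro!: exI[of _ "s' - t'"] simp: c_diff algebra_simps)
  qed

  define N where "N x = U \<inter> ({Aff x y | y. True} \<union> {Infty})" for x
  define L where "L a d = U \<inter> ({Aff x (f (x + a) - d) | x. True} \<union> {Slope a})" for a d
  have mem_N [simp]: "Aff x' y \<in> N x \<longleftrightarrow> x' = x \<and> y \<in> T" "Infty \<in> N x" for x x' y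
    by (auto simp: N_def)
  have mem_L [simp]: "Aff x y \<in> L a d \<longleftrightarrow> y = f (x + a) - d \<and> y \<in> T" "Infty \<notin> L a d"
    "Slope s \<notin> L a d" for x y a d s
    by (auto simp: L_def)
  have secant: "U \<inter> l \<in> BU \<and> card (U \<inter> l) = q + 1"
    if l: "l \<in> Pi_lines f" and PQ: "P \<in> U \<inter> l" "Q \<in> U \<inter> l" "P \<noteq> Q" for l P Q
  proof -
    have "card (U \<inter> l) \<noteq> 1" using PQ by (metis card_1_singletonE singletonD)
    then show ?thesis using l unital(2) unfolding BU_def unital_blocks_def by auto
  qed
  have N_line: "{Aff x y | y. True} \<union> {Infty} \<in> Pi_lines f" for x
    unfolding Pi_lines_def by blast
  have L_line: "{Aff x (f (x + a) - d) | x. True} \<union> {Slope a} \<in> Pi_lines f" for a d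
    unfolding Pi_lines_def by blast
  have N_BU: "N x \<in> BU" for x
    using secant[OF N_line, of "Aff x 0" x Infty] zero_T unfolding N_def by auto
  have L_BU: "L a d \<in> BU" "card (L a d) = q + 1"
    if "P \<in> L a d" "Q \<in> L a d" "P \<noteq> Q" for a d P Q
    using secant[OF L_line] that unfolding L_def by blast+
  have L_join: "\<exists>a d. y1 = f (x1 + a) - d \<and> y2 = f (x2 + a) - d" if x12: "x1 \<noteq> x2" for x1 x2 y1 y2
  proof -
    have "surj (\<lambda>x. f (x + (x1 - x2)) - f x)"
      using assms(6) x12 by (simp add: planar_def bij_def)
    then obtain z where z: "y1 - y2 = f (z + (x1 - x2)) - f z"
      unfolding surj_def by blast
    have "y1 = f (x1 + (z - x2)) - (f z - y2)" "y2 = f (x2 + (z - x2)) - (f z - y2)"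
      using z by (simp_all add: algebra_simps)
    then show ?thesis by blast
  qed

  define E where "E = \<phi> Infty"
  have E_H: "E \<in> hermitian q"
    using bij_betwE[OF \<phi>] by (simp add: E_def flip: H_def)
  have c_power: "c x = x ^ q" for x by (simp add: c_def)
  obtain pt where pt: "bij_betw (\<lambda>(x, y). pt x y) {(x, y). y + c y = x * c x} (H - {E})"
    and PG: "\<And>l. l \<in> PG_lines \<Longrightarrow> \<exists>A B C. (A, B, C) \<noteq> (0, 0, 0) \<and> (E \<in> l \<longleftrightarrow> C = 0) \<and>
       (\<forall>x y. pt x y \<in> l \<longleftrightarrow> A + B * x + C * y = 0)"
    unfolding H_def by (fact hermitian_coordinates[OF c_power E_H])
  have \<phi>_block: "\<exists>l\<in>PG_lines. \<phi> ` B = H \<inter> l" if "B \<in> BU" for B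
  proof -
    have "\<phi> ` B \<in> BH" using that blocks by blast
    then show ?thesis unfolding BH_def unital_blocks_def by blast
  qed
  have \<phi>_mem: "\<phi> P \<in> \<phi> ` B \<longleftrightarrow> P \<in> B" if "B \<in> BU" "P \<in> U" for P B
  proof -
    have "B \<subseteq> U" using that unfolding BU_def unital_blocks_def by blast
    then show ?thesis using \<phi> that by (meson bij_betw_imp_inj_on inj_on_image_mem_iff)
  qed
  define XY where "XY P = inv_into {(x, y). y + c y = x * c x} (\<lambda>(x, y). pt x y) (\<phi> P)" for P
  define X where "X x y = fst (XY (Aff x y))" for x y
  define Y where "Y x y = snd (XY (Aff x y))" for x y
  have coords: "\<phi> (Aff x y) = pt (X x y) (Y x y)" "Y x y + c (Y x y) = X x y * c (X x y)"
    if y: "y \<in> T" for x y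
  proof -
    have "\<phi> (Aff x y) \<noteq> E"
      using bij_betw_imp_inj_on[OF \<phi>] y unfolding E_def by (auto dest: inj_onD)
    then have im: "\<phi> (Aff x y) \<in> (\<lambda>(x, y). pt x y) ` {(x, y). y + c y = x * c x}"
      unfolding bij_betw_imp_surj_on[OF pt] using bij_betwE[OF \<phi>] y by simp
    from inv_into_into[OF im] f_inv_into_f[OF im]
    show "\<phi> (Aff x y) = pt (X x y) (Y x y)" "Y x y + c (Y x y) = X x y * c (X x y)"
      unfolding X_def Y_def XY_def by (auto simp: case_prod_unfold)
  qed
  have N_image: "\<phi> P \<in> \<phi> ` N x \<longleftrightarrow> X x' y' = X x 0" if P: "P = Aff x' y'" "y' \<in> T" for P x x' y'
  proof -
    obtain l where l: "l \<in> PG_lines" "\<phi> ` N x = H \<inter> l" using \<phi>_block[OF N_BU] by blast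
    obtain A B C where ABC: "(A, B, C) \<noteq> (0, 0, 0)" "E \<in> l \<longleftrightarrow> C = 0"
      "\<And>x y. pt x y \<in> l \<longleftrightarrow> A + B * x + C * y = 0"
      using PG[OF l(1)] by blast
    have "E \<in> l" using l(2) \<phi>_mem[OF N_BU Infty_U] unfolding E_def by auto
    then have C: "C = 0" using ABC(2) by blast
    have "\<phi> (Aff x 0) \<in> l" using l(2) \<phi>_mem[OF N_BU, of "Aff x 0" x] zero_T by auto
    then have A: "A = - B * X x 0" using ABC(3) coords(1)[OF zero_T] C by (simp add: add_eq_0_iff2)
    then have B: "B \<noteq> 0" using ABC(1) C by auto
    have "\<phi> P \<in> H" using P bij_betwE[OF \<phi>] by simp
    then have "\<phi> P \<in> \<phi> ` N x \<longleftrightarrow> B * (X x' y' - X x 0) = 0"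
      unfolding l(2) P using ABC(3) coords(1)[OF P(2)] C A by (simp add: algebra_simps)
    then show ?thesis using B by simp
  qed
  define b where "b x = X x 0" for x
  have X_eq: "X x y = b x" if y: "y \<in> T" for x y
    using N_image[OF refl y, of x x] \<phi>_mem[OF N_BU, of "Aff x y" x] y by (simp add: b_def)
  have b_inj: "x' = x" if "b x' = b x" for x x'
    using N_image[OF refl zero_T, of x' x] \<phi>_mem[OF N_BU, of "Aff x' 0" x] that zero_T
    by (simp add: b_def)
  have "bij b"
    using b_inj finite_UNIV_inj_surj[of b] by (auto simp: bij_def inj_def)
  have block_image: "\<exists>m k. \<forall>x y. y \<in> T \<longrightarrow> (Aff x y \<in> B \<longleftrightarrow> Y x y = m * b x + k)"
    if B: "B \<in> BU" and P: "Aff x1 y1 \<in> B" "Aff x2 y2 \<in> B" "x1 \<noteq> x2" for B x1 y1 x2 y2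
  proof -
    have BU: "B \<subseteq> U" using B unfolding BU_def unital_blocks_def by blast
    then have y12: "y1 \<in> T" "y2 \<in> T" using P by auto
    obtain l where l: "l \<in> PG_lines" "\<phi> ` B = H \<inter> l" using \<phi>_block[OF B] by blast
    obtain A B' C where ABC: "(A, B', C) \<noteq> (0, 0, 0)"
      "\<And>x y. pt x y \<in> l \<longleftrightarrow> A + B' * x + C * y = 0"
      using PG[OF l(1)] by blast
    have mem: "Aff x y \<in> B \<longleftrightarrow> A + B' * b x + C * Y x y = 0" if y: "y \<in> T" for x y
    proof -
      have "Aff x y \<in> B \<longleftrightarrow> \<phi> (Aff x y) \<in> H \<inter> l"
        using \<phi>_mem[OF B, of "Aff x y"] y l(2) by simp
      also have "\<dots> \<longleftrightarrow> \<phi> (Aff x y) \<in> l" using bij_betwE[OF \<phi>] y by simp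
      finally show ?thesis using ABC(2) coords(1)[OF y] X_eq[OF y] by simp
    qed
    have "b x1 \<noteq> b x2" using P(3) b_inj by blast
    moreover have "A + B' * b x1 + C * Y x1 y1 = 0" "A + B' * b x2 + C * Y x2 y2 = 0"
      using mem y12 P by simp_all
    ultimately obtain m k where "\<And>x y. A + B' * x + C * y = 0 \<longleftrightarrow> y = m * x + k"
      using line_slope_form[OF ABC(1)] by blast
    then show ?thesis using mem by blast
  qed
  interpret planar_hermitian c f T b Y
  proof
    show "finite (UNIV :: 'a set)" by simp
    show "odd (card {t. c t = t})" using card_fixed q_odd by simp
    show "f (- x) = f x" for x by (rule even_if_DO_or_CM[OF assms(2,7)])
    show "0 \<in> T" by (rule zero_T)
    show "s - t \<in> T" if "s \<in> T" "t \<in> T" for s t using that by (rule diff_T)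
    show "bij b" by fact
    show "Y x y + c (Y x y) = b x * c (b x)" if "y \<in> T" for x y
      using coords(2)[OF that] X_eq[OF that] by simp
    show "\<exists>y\<in>T. Y x y = h" if h: "h + c h = b x * c (b x)" for x h
    proof -
      have "pt (b x) h \<in> H - {E}" using bij_betwE[OF pt] h by auto
      then obtain P where P: "P \<in> U" "\<phi> P = pt (b x) h" "P \<noteq> Infty"
        using \<phi> unfolding bij_betw_def E_def by (metis DiffD1 DiffD2 imageE singletonI)
      then obtain x' y where y: "P = Aff x' y" "y \<in> T" by (auto simp: U_eq)
      have "(X x' y, Y x' y) = (b x, h)"
      proof (rule inj_onD[OF bij_betw_imp_inj_on[OF pt]])
        show "(case (X x' y, Y x' y) of (x, y) \<Rightarrow> pt x y) = (case (b x, h) of (x, y) \<Rightarrow> pt x y)"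
          using coords(1)[OF y(2), of x'] P(2) y(1) by simp
      qed (use coords(2)[OF y(2)] h in auto)
      then have "x' = x" "Y x' y = h" using X_eq[OF y(2)] b_inj by auto
      then show ?thesis using y(2) by blast
    qed
  next
    fix x1 x2 x3 y1 y2 y3 :: 'a
    assume x: "x1 \<noteq> x2" "x2 \<noteq> x3" "x1 \<noteq> x3" and y: "y1 \<in> T" "y2 \<in> T" "y3 \<in> T"
    have image: "\<exists>m k. \<forall>x y. y \<in> T \<longrightarrow> (y = f (x + a) - d \<longleftrightarrow> Y x y = m * b x + k)"
      if "y1 = f (x1 + a) - d" "y2 = f (x2 + a) - d" for a d
    proof -
      have mem: "Aff x1 y1 \<in> L a d" "Aff x2 y2 \<in> L a d" using that y by simp_all
      then have "L a d \<in> BU" using L_BU(1) x(1) by blast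
      from block_image[OF this mem x(1)] show ?thesis by simp
    qed
    show "(\<exists>a d. y1 = f (x1 + a) - d \<and> y2 = f (x2 + a) - d \<and> y3 = f (x3 + a) - d) \<longleftrightarrow>
      (\<exists>m k. Y x1 y1 = m * b x1 + k \<and> Y x2 y2 = m * b x2 + k \<and> Y x3 y3 = m * b x3 + k)"
    proof
      assume "\<exists>a d. y1 = f (x1 + a) - d \<and> y2 = f (x2 + a) - d \<and> y3 = f (x3 + a) - d"
      then obtain a d where ad: "y1 = f (x1 + a) - d" "y2 = f (x2 + a) - d" "y3 = f (x3 + a) - d"
        by blast
      show "\<exists>m k. Y x1 y1 = m * b x1 + k \<and> Y x2 y2 = m * b x2 + k \<and> Y x3 y3 = m * b x3 + k"
        using image[OF ad(1,2)] ad y by blast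
    next
      assume "\<exists>m k. Y x1 y1 = m * b x1 + k \<and> Y x2 y2 = m * b x2 + k \<and> Y x3 y3 = m * b x3 + k"
      then obtain m k where mk: "Y x1 y1 = m * b x1 + k" "Y x2 y2 = m * b x2 + k"
        "Y x3 y3 = m * b x3 + k" by blast
      obtain a d where ad: "y1 = f (x1 + a) - d" "y2 = f (x2 + a) - d"
        using L_join[OF x(1)] by blast
      obtain m' k' where m'k': "\<And>x y. y \<in> T \<Longrightarrow> y = f (x + a) - d \<longleftrightarrow> Y x y = m' * b x + k'"
        using image[OF ad] by blast
      have eq: "m * b x1 + k = m' * b x1 + k'" "m * b x2 + k = m' * b x2 + k'"
        using m'k' y ad mk by metis+
      have "(m - m') * (b x1 - b x2) =
          (m * b x1 + k - (m' * b x1 + k')) - (m * b x2 + k - (m' * b x2 + k'))"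
        by (simp add: algebra_simps)
      also have "\<dots> = 0" unfolding eq by simp
      finally have "m = m'" using b_inj x(1) by auto
      then have "Y x3 y3 = m' * b x3 + k'" using eq mk(3) by simp
      then show "\<exists>a d. y1 = f (x1 + a) - d \<and> y2 = f (x2 + a) - d \<and> y3 = f (x3 + a) - d"
        using m'k'[OF y(3)] ad by blast
    qed
  next
    fix x1 x2 a :: 'a
    assume x: "x1 \<noteq> x2" and t: "f (x2 + a) - f (x1 + a) \<in> T"
    let ?B = "L a (f (x1 + a))"
    define P1 P2 where "P1 = Aff x1 0" and "P2 = Aff x2 (f (x2 + a) - f (x1 + a))"
    have mem: "P1 \<in> ?B" "P2 \<in> ?B" "P1 \<noteq> P2"
      using t zero_T x by (simp_all add: P1_def P2_def)
    have "card ?B = q + 1" using L_BU(2)[OF mem] .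
    moreover have "card {P1, P2} \<le> 2" by (simp add: card_insert_if)
    ultimately have "\<not> ?B \<subseteq> {P1, P2}"
      using card_mono[of "{P1, P2}" ?B] q3 by auto
    then obtain P where P: "P \<in> ?B" "P \<noteq> P1" "P \<noteq> P2" by blast
    then obtain x3 y3 where P': "P = Aff x3 y3" "y3 = f (x3 + a) - f (x1 + a)" "y3 \<in> T"
      by (cases P) simp_all
    then show "\<exists>x3. x3 \<noteq> x1 \<and> x3 \<noteq> x2 \<and> f (x3 + a) - f (x1 + a) \<in> T"
      using P(2,3) unfolding P1_def P2_def by (intro exI[of _ x3]) auto
  qed
  show False using conjugation_trivial j by blast
qed

end
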